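(* Let $N$ be a natural number, let $A$ and $B$ be arbitrary sets, and let $u, v : A^{N+1}\times B^{N+1}\to\mathbb{R}$ be arbitrary functions. Consider the finite-stage two-player game with alternating moves with stages $0,1,\dots,N$, action sets $A$ (player 1) and $B$ (player 2), and payoff functions $u$ (player 1) and $v$ (player 2). Then at least one of the following holds: (i) player 1 has a winning strategy; or (ii) player 2 has a winning strategy; or (iii) both players have unbeatable strategies (i.e. player 1 has an unbeatable strategy and player 2 has an unbeatable strategy).
   Context: Finite-stage game with alternating moves. At each stage $t=0,1,\dots,N$, player 1 first chooses an action $a_t\in A$, and then player 2 chooses an action $b_t\in B$; each player observes all previous moves. Write $a^{t}=(a_0,\dots,a_t)$ and $b^{t}=(b_0,\dots,b_t)$. A strategy of player 1 is a sequence $\xi=\{x_0, x_1(a^0,b^0), x_2(a^1,b^1),\dots,x_N(a^{N-1},b^{N-1})\}$, where $x_0\in A$ and, for $1\le t\le N$, $x_t: A^t\times B^t\to A$ is a function. A strategy of player 2 is a sequence of functions $\eta=\{y_0(a^0), y_1(a^1,b^0),\dots,y_N(a^N,b^{N-1})\}$, where $y_t: A^{t+1}\times B^t\to B$ for $0\le t\le N$. The outcome $h(\xi,\eta)=(a_0,\dots,a_N,b_0,\dots,b_N)$ of the strategies $\xi,\eta$ is the history of play defined recursively by $a_0=x_0$, $b_0=y_0(a^0)$, and $a_t=x_t(a^{t-1},b^{t-1})$, $b_t=y_t(a^t,b^{t-1})$ for $1\le t\le N$. The payoffs are $U(\xi,\eta)=u(h(\xi,\eta))$ for player 1 and $V(\xi,\eta)=v(h(\xi,\eta))$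 for player 2. A strategy $\xi$ of player 1 is winning if $U(\xi,\eta)>V(\xi,\eta)$ for every strategy $\eta$ of player 2, and unbeatable if $U(\xi,\eta)\ge V(\xi,\eta)$ for every strategy $\eta$ of player 2. A strategy $\eta$ of player 2 is winning if $U(\xi,\eta)<V(\xi,\eta)$ for every strategy $\xi$ of player 1, and unbeatable if $U(\xi,\eta)\le V(\xi,\eta)$ for every strategy $\xi$ of player 1. *)

theory Defs
  imports Complex_Main "HOL-Library.NList" "HOL-Library.FuncSet"
begin

text \<open>
  Two players move alternately at the stages \<open>0, \<dots>, N\<close>; player 1 moves first at each stage.
  The sequences \<open>a\<^sup>t = (a\<^sub>0, \<dots>, a\<^sub>t)\<close> and \<open>b\<^sup>t = (b\<^sub>0, \<dots>, b\<^sub>t)\<close> are lists of length \<open>t + 1\<close>, in order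
  of play, so the power \<open>A\<^sup>t\<close> is \<^term>\<open>nlists t A\<close>. The action sets may be empty.
\<close>

type_synonym ('a, 'b) strategy1 = "nat \<Rightarrow> 'a list \<times> 'b list \<Rightarrow> 'a"
type_synonym ('a, 'b) strategy2 = "nat \<Rightarrow> 'a list \<times> 'b list \<Rightarrow> 'b"

text \<open>
  The initial move \<open>x\<^sub>0 \<in> A\<close> of player 1 is represented as a function on the one-point set
  \<open>A\<^sup>0 \<times> B\<^sup>0 = {([], [])}\<close>.
\<close>

definition strategies1 :: "nat \<Rightarrow> 'a set \<Rightarrow> 'b set \<Rightarrow> ('a, 'b) strategy1 set" where
  "strategies1 N A B = (\<Pi>\<^sub>E t\<in>{..N}. nlists t A \<times> nlists t B \<rightarrow>\<^sub>E A)"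

definition strategies2 :: "nat \<Rightarrow> 'a set \<Rightarrow> 'b set \<Rightarrow> ('a, 'b) strategy2 set" where
  "strategies2 N A B = (\<Pi>\<^sub>E t\<in>{..N}. nlists (Suc t) A \<times> nlists t B \<rightarrow>\<^sub>E B)"

text \<open>\<open>play x y t\<close> is the history of the first \<open>t\<close> stages, that is, of the stages \<open>0, \<dots>, t - 1\<close>.\<close>

primrec play :: "('a, 'b) strategy1 \<Rightarrow> ('a, 'b) strategy2 \<Rightarrow> nat \<Rightarrow> 'a list \<times> 'b list" where
  "play x y 0 = ([], [])"
| "play x y (Suc t) =
     (let (as, bs) = play x y t;
          a = x t (as, bs);
          b = y t (as @ [a], bs)
      in (as @ [a], bs @ [b]))"

definition outcome :: "nat \<Rightarrow> ('a, 'b) strategy1 \<Rightarrow> ('a, 'b) strategy2 \<Rightarrow> 'a list \<times> 'b list" where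
  "outcome N x y = play x y (Suc N)"

definition payoff ::
  "nat \<Rightarrow> ('a list \<times> 'b list \<Rightarrow> real) \<Rightarrow> ('a, 'b) strategy1 \<Rightarrow> ('a, 'b) strategy2 \<Rightarrow> real" where
  "payoff N w x y = w (outcome N x y)"

definition winning1 ::
  "nat \<Rightarrow> 'a set \<Rightarrow> 'b set \<Rightarrow> ('a list \<times> 'b list \<Rightarrow> real) \<Rightarrow> ('a list \<times> 'b list \<Rightarrow> real)
    \<Rightarrow> ('a, 'b) strategy1 \<Rightarrow> bool" where
  "winning1 N A B u v x \<longleftrightarrow>
     x \<in> strategies1 N A B \<and> (\<forall>y\<in>strategies2 N A B. payoff N u x y > payoff N v x y)"

definition unbeatable1 ::
  "nat \<Rightarrow> 'a set \<Rightarrow> 'b set \<Rightarrow> ('a list \<times> 'b list \<Rightarrow> real) \<Rightarrow> ('a list \<times> 'b list \<Rightarrow> real)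
    \<Rightarrow> ('a, 'b) strategy1 \<Rightarrow> bool" where
  "unbeatable1 N A B u v x \<longleftrightarrow>
     x \<in> strategies1 N A B \<and> (\<forall>y\<in>strategies2 N A B. payoff N u x y \<ge> payoff N v x y)"

definition winning2 ::
  "nat \<Rightarrow> 'a set \<Rightarrow> 'b set \<Rightarrow> ('a list \<times> 'b list \<Rightarrow> real) \<Rightarrow> ('a list \<times> 'b list \<Rightarrow> real)
    \<Rightarrow> ('a, 'b) strategy2 \<Rightarrow> bool" where
  "winning2 N A B u v y \<longleftrightarrow>
     y \<in> strategies2 N A B \<and> (\<forall>x\<in>strategies1 N A B. payoff N u x y < payoff N v x y)"

definition unbeatable2 ::
  "nat \<Rightarrow> 'a set \<Rightarrow> 'b set \<Rightarrow> ('a list \<times> 'b list \<Rightarrow> real) \<Rightarrow> ('a list \<times> 'b list \<Rightarrow> real)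
    \<Rightarrow> ('a, 'b) strategy2 \<Rightarrow> bool" where
  "unbeatable2 N A B u v y \<longleftrightarrow>
     y \<in> strategies2 N A B \<and> (\<forall>x\<in>strategies1 N A B. payoff N u x y \<le> payoff N v x y)"

end

theory Submission imports Defs begin

text \<open>
  The result is Zermelo's backward induction, used twice. For any property \<open>W\<close> of complete
  histories, either player 1 can enforce \<open>W\<close> or player 2 can enforce its negation
  (\<open>enforce_or_prevent\<close>): call a position secure when player 1 has a move there such that every
  reply leads to a secure position again. If the empty history is secure, player 1 keeps to secure
  positions; if not, player 2 keeps to insecure ones.

  With \<open>W\<close> as \<open>u > v\<close>, either player 1 has a winning strategy or player 2 has an unbeatable one.
  With \<open>W\<close> as \<open>u \<ge> v\<close>, either player 1 has an unbeatable strategy or player 2 has a winning one.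
  If neither player has a winning strategy, then both have unbeatable ones.

  Empty action sets fit the same argument. If \<open>A = {}\<close>, no position with a stage still to be played
  is secure, and player 2 has a strategy because there is never a move to reply to. If \<open>B = {}\<close>
  while \<open>A\<close> is nonempty, every such position is vacuously secure.
\<close>

(* As simplification rules, these make every length or set of a list a search for a membership in
   nlists with free parameters, and that search need not end. *)
declare nlistsE_length [simp del] nlistsE_set [simp del]

primrec secure ::
  "'a set \<Rightarrow> 'b set \<Rightarrow> ('a list \<times> 'b list \<Rightarrow> bool) \<Rightarrow> nat \<Rightarrow> 'a list \<Rightarrow> 'b list \<Rightarrow> bool" where
  "secure A B W 0 as bs \<longleftrightarrow> W (as, bs)"
| "secure A B W (Suc k) as bs \<longleftrightarrow> (\<exists>a\<in>A. \<forall>b\<in>B. secure A B W k (as @ [a]) (bs @ [b]))"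

text \<open>
  The strategy sets of both players have this form. The choice of a move may thus be made separately
  at each stage and each position, and the values off the domain can be set to \<open>undefined\<close>.
\<close>

lemma strategy_choice:
  assumes "\<And>t h. t \<in> T \<Longrightarrow> h \<in> H t \<Longrightarrow> \<exists>c\<in>C. Q t h c"
  shows "\<exists>f\<in>(\<Pi>\<^sub>E t\<in>T. H t \<rightarrow>\<^sub>E C). \<forall>t\<in>T. \<forall>h\<in>H t. Q t h (f t h)"
proof -
  define f where "f = (\<lambda>t\<in>T. \<lambda>h\<in>H t. SOME c. c \<in> C \<and> Q t h c)"
  have f: "f t h \<in> C \<and> Q t h (f t h)" if "t \<in> T" "h \<in> H t" for t h
  proof -
    have "\<exists>c. c \<in> C \<and> Q t h c"
      using assms[OF that] by blast
    from someI_ex[OF this] show ?thesis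
      using that by (simp add: f_def)
  qed
  have "f \<in> (\<Pi>\<^sub>E t\<in>T. H t \<rightarrow>\<^sub>E C)"
  proof (rule PiE_I)
    fix t assume t: "t \<in> T"
    show "f t \<in> H t \<rightarrow>\<^sub>E C"
      using f[OF t] t by (auto simp: f_def)
  qed (simp add: f_def)
  then show ?thesis
    using f by blast
qed

lemma strategies1_move:
  assumes "x \<in> strategies1 N A B" "t \<le> N" "as \<in> nlists t A" "bs \<in> nlists t B"
  shows "x t (as, bs) \<in> A"
proof -
  have "x t \<in> nlists t A \<times> nlists t B \<rightarrow>\<^sub>E A"
    using PiE_mem[OF assms(1)[unfolded strategies1_def], of t] assms(2) by simp
  then show ?thesis
    using assms(3,4) by (auto intro: PiE_mem)
qed

lemma strategies2_move:
  assumes "y \<in> strategies2 N A B" "t \<le> N" "as \<in> nlists (Suc t) A" "bs \<in> nlists t B"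
  shows "y t (as, bs) \<in> B"
proof -
  have "y t \<in> nlists (Suc t) A \<times> nlists t B \<rightarrow>\<^sub>E B"
    using PiE_mem[OF assms(1)[unfolded strategies2_def], of t] assms(2) by simp
  then show ?thesis
    using assms(3,4) by (auto intro: PiE_mem)
qed

lemma nlists_snoc:
  assumes "xs \<in> nlists n S" "s \<in> S"
  shows "xs @ [s] \<in> nlists (Suc n) S"
  using assms by (auto simp: nlists_def)

text \<open>
  An invariant of positions that survives every stage holds for the outcome. The hypothesis on a
  stage offers what either player needs in order to check this: the moves are legal, and each is the
  one prescribed by its strategy.
\<close>

lemma outcome_invariant:
  assumes x: "x \<in> strategies1 N A B" and y: "y \<in> strategies2 N A B"
    and start: "I 0 [] []"
    and stage: "\<And>t as bs a b. \<lbrakk>t \<le> N; as \<in> nlists t A; bs \<in> nlists t B; I t as bs;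
      a \<in> A; b \<in> B; a = x t (as, bs); b = y t (as @ [a], bs)\<rbrakk>
      \<Longrightarrow> I (Suc t) (as @ [a]) (bs @ [b])"
  shows "\<exists>as bs. outcome N x y = (as, bs) \<and> I (Suc N) as bs"
proof -
  have "\<exists>as bs. play x y t = (as, bs) \<and> as \<in> nlists t A \<and> bs \<in> nlists t B \<and> I t as bs"
    if "t \<le> Suc N" for t
    using that
  proof (induction t)
    case 0
    then show ?case
      using start by simp
  next
    case (Suc t)
    then obtain as bs where p: "play x y t = (as, bs)"
      and h: "as \<in> nlists t A" "bs \<in> nlists t B" "I t as bs"
      by auto
    have t: "t \<le> N"
      using Suc.prems by simp
    define a where "a = x t (as, bs)"
    define b where "b = y t (as @ [a], bs)"
    have a: "a \<in> A"
      unfolding a_def by (rule strategies1_move[OF x t h(1,2)])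
    have b: "b \<in> B"
      unfolding b_def by (rule strategies2_move[OF y t nlists_snoc[OF h(1) a] h(2)])
    have "I (Suc t) (as @ [a]) (bs @ [b])"
      by (rule stage[OF t h a b a_def b_def])
    moreover have "play x y (Suc t) = (as @ [a], bs @ [b])"
      by (simp add: p a_def b_def Let_def)
    ultimately show ?case
      using nlists_snoc[OF h(1) a] nlists_snoc[OF h(2) b] by simp
  qed
  from this[of "Suc N"] obtain as bs where "play x y (Suc N) = (as, bs)" "I (Suc N) as bs"
    by blast
  then show ?thesis
    by (metis outcome_def)
qed

text \<open>
  The strategy needs a move at every position, also at insecure ones, which it never reaches; any
  element of \<open>A\<close> will do there, and \<open>A\<close> is nonempty because the empty history is secure.
\<close>

lemma secure_imp_enforce:
  assumes sec: "secure A B W (Suc N) [] []"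
  shows "\<exists>x\<in>strategies1 N A B. \<forall>y\<in>strategies2 N A B. W (outcome N x y)"
proof -
  define Q where "Q t h a \<longleftrightarrow> (secure A B W (Suc (N - t)) (fst h) (snd h) \<longrightarrow>
    (\<forall>b\<in>B. secure A B W (N - t) (fst h @ [a]) (snd h @ [b])))" for t h a
  have "\<exists>a\<in>A. Q t h a" for t h
    using sec by (auto simp: Q_def)
  then obtain x where x: "x \<in> strategies1 N A B"
    and move: "\<forall>t\<in>{..N}. \<forall>h\<in>nlists t A \<times> nlists t B. Q t h (x t h)"
    using strategy_choice[of "{..N}" "\<lambda>t. nlists t A \<times> nlists t B" A Q]
    unfolding strategies1_def by blast
  have "W (outcome N x y)" if y: "y \<in> strategies2 N A B" for y
  proof -
    have "\<exists>as bs. outcome N x y = (as, bs) \<and> secure A B W (Suc N - Suc N) as bs"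
    proof (rule outcome_invariant[OF x y, where I = "\<lambda>t. secure A B W (Suc N - t)"])
      show "secure A B W (Suc N - 0) [] []"
        using sec by simp
    next
      fix t as bs a b
      assume "t \<le> N" "as \<in> nlists t A" "bs \<in> nlists t B" "secure A B W (Suc N - t) as bs"
        "b \<in> B" "a = x t (as, bs)"
      then show "secure A B W (Suc N - Suc t) (as @ [a]) (bs @ [b])"
        using move by (simp add: Q_def Suc_diff_le del: secure.simps)
    qed
    then show ?thesis
      by auto
  qed
  with x show ?thesis
    by blast
qed

text \<open>
  Player 2 sees the current move of player 1 as the last entry of the history, so the position
  from which that move was made is recovered by \<open>butlast\<close>.
\<close>

lemma not_secure_imp_prevent:
  assumes insec: "\<not> secure A B W (Suc N) [] []"
  shows "\<exists>y\<in>strategies2 N A B. \<forall>x\<in>strategies1 N A B. \<not> W (outcome N x y)"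
proof -
  define Q where "Q t h b \<longleftrightarrow> (\<not> secure A B W (Suc (N - t)) (butlast (fst h)) (snd h) \<longrightarrow>
    \<not> secure A B W (N - t) (fst h) (snd h @ [b]))" for t h b
  have "\<exists>b\<in>B. Q t h b" if h: "h \<in> nlists (Suc t) A \<times> nlists t B" for t h
  proof -
    obtain as bs where "h = (as, bs)" and as: "length as = Suc t" "set as \<subseteq> A"
      using h by (auto simp: nlists_def)
    moreover obtain as' a where "as = as' @ [a]"
      using as(1) by (cases as rule: rev_cases) auto
    ultimately have h_eq: "h = (as' @ [a], bs)" and a: "a \<in> A"
      by auto
    (* At a secure position the reply is arbitrary, but B must be nonempty: a first move in A
       exists, and as the empty history is insecure, some reply refutes it. *)
    have "B \<noteq> {}"
      using insec a by auto
    moreover have "\<exists>b\<in>B. \<not> secure A B W (N - t) (as' @ [a]) (bs @ [b])"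
      if "\<not> secure A B W (Suc (N - t)) as' bs"
      using that a by auto
    ultimately show ?thesis
      by (auto simp: Q_def h_eq simp del: secure.simps)
  qed
  then obtain y where y: "y \<in> strategies2 N A B"
    and move: "\<forall>t\<in>{..N}. \<forall>h\<in>nlists (Suc t) A \<times> nlists t B. Q t h (y t h)"
    using strategy_choice[of "{..N}" "\<lambda>t. nlists (Suc t) A \<times> nlists t B" B Q]
    unfolding strategies2_def by blast
  have "\<not> W (outcome N x y)" if x: "x \<in> strategies1 N A B" for x
  proof -
    have "\<exists>as bs. outcome N x y = (as, bs) \<and> \<not> secure A B W (Suc N - Suc N) as bs"
    proof (rule outcome_invariant[OF x y, where I = "\<lambda>t as bs. \<not> secure A B W (Suc N - t) as bs"])
      show "\<not> secure A B W (Suc N - 0) [] []"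
        using insec by simp
    next
      fix t as bs a b
      assume t: "t \<le> N" and h: "as \<in> nlists t A" "bs \<in> nlists t B"
        and pos: "\<not> secure A B W (Suc N - t) as bs"
        and a: "a \<in> A" and b: "b = y t (as @ [a], bs)"
      have "Q t (as @ [a], bs) b"
        using move t h(2) nlists_snoc[OF h(1) a] unfolding b by simp
      then show "\<not> secure A B W (Suc N - Suc t) (as @ [a]) (bs @ [b])"
        using pos t by (simp add: Q_def Suc_diff_le del: secure.simps)
    qed
    then show ?thesis
      by auto
  qed
  with y show ?thesis
    by blast
qed

lemma enforce_or_prevent:
  "(\<exists>x\<in>strategies1 N A B. \<forall>y\<in>strategies2 N A B. W (outcome N x y)) \<or>
   (\<exists>y\<in>strategies2 N A B. \<forall>x\<in>strategies1 N A B. \<not> W (outcome N x y))"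
  using secure_imp_enforce not_secure_imp_prevent by blast

theorem theorem2:
  fixes N :: nat and A :: "'a set" and B :: "'b set"
    and u v :: "'a list \<times> 'b list \<Rightarrow> real"
  shows "(\<exists>x. winning1 N A B u v x) \<or>
         (\<exists>y. winning2 N A B u v y) \<or>
         ((\<exists>x. unbeatable1 N A B u v x) \<and> (\<exists>y. unbeatable2 N A B u v y))"
proof -
  have "(\<exists>x. winning1 N A B u v x) \<or> (\<exists>y. unbeatable2 N A B u v y)"
    using enforce_or_prevent[of N A B "\<lambda>h. u h > v h"]
    unfolding winning1_def unbeatable2_def payoff_def not_less by blast
  moreover have "(\<exists>x. unbeatable1 N A B u v x) \<or> (\<exists>y. winning2 N A B u v y)"
    using enforce_or_prevent[of N A B "\<lambda>h. u h \<ge> v h"]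
    unfolding unbeatable1_def winning2_def payoff_def not_le by blast
  ultimately show ?thesis
    by blast
qed

end
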